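(* Let $X$ be a Hausdorff locally convex topological vector space with dual $X^*$, $e$ an error function on $X\times X$, and $f:X\to\mathbb{R}\cup\{+\infty\}$ a proper and $e$-convex function. Assume that $e$ is defined (real-valued) on all of $X\times X$, satisfies the triangle inequality $e(z,x)\le e(z,y)+e(y,x)$ for all $x,y,z\in X$, and that for all $z\in\operatorname{dom} f$, $e(z,z)=0$ and $e(\cdot,z)|_{\operatorname{dom} f}$ is upper semicontinuous. If $x\in\operatorname{dom} f$ and $\partial^{CR}f(x)\ne\emptyset$, then for $x^*\in X^*$ the following assertions are equivalent: (i) $x^*\in\partial^e f(x)$; (ii) $x\in\partial f^*_{e,x}(x^* )$; (iii) $x^*\in\partial f^{**}_{e,x}(x)$.
   Context: For an extended-real-valued function $h$, $\operatorname{dom} h=\{h<+\infty\}$; $f:X\to\mathbb{R}\cup\{+\infty\}$ is proper if $\operatorname{dom} f\ne\emptyset$. An error function is a map $e:X\times X\to\mathbb{R}\cup\{+\infty\}$ that is nonnegative, symmetric, and has nonempty domain $\operatorname{dom} e=\{(x,y): e(x,y)<+\infty\}$. $f$ is $e$-convex if $\operatorname{dom} f\times\operatorname{dom} f\subset\operatorname{dom} e$ and $f(tx+(1-t)y)\le tf(x)+(1-t)f(y)+t(1-t)e(x,y)$ for all $x,y\in X$, $t\in\,]0,1[$. For fixed $y\in X$: $(e,y)$-conjugate $f^*_{e,y}(x^* )=\sup_{x\in X}\{\langle x^*,x\rangle-f(x)-e(x,y)\}$, $x^*\in X^*$; $(e,y)$-biconjugate $f^{**}_{e,y}(x)=\sup_{x^*\in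 X^*}\{\langle x^*,x\rangle-f^*_{e,y}(x^* )\}$, $x\in X$. $e$-subdifferential: $\partial^e f(x)=\{x^*\in X^*:\langle y-x,x^*\rangle\le f(y)-f(x)+e(x,y)\ \forall y\in X\}$ for $x\in\operatorname{dom} f$, empty otherwise. $\partial$ denotes the subdifferential of convex analysis: $x\in\partial f^*_{e,x}(x^* )$ means $x^*\in\operatorname{dom} f^*_{e,x}$ and $\langle z^*-x^*,x\rangle\le f^*_{e,x}(z^* )-f^*_{e,x}(x^* )$ for all $z^*\in X^*$; $x^*\in\partial f^{**}_{e,x}(x)$ means $x\in\operatorname{dom} f^{**}_{e,x}$ and $\langle x^*,y-x\rangle\le f^{**}_{e,x}(y)-f^{**}_{e,x}(x)$ for all $y\in X$. Clarke–Rockafellar generalized directional derivative at $x\in\operatorname{dom} f$ in direction $z$: $f^{\uparrow}(x,z)=\sup_{U}\limsup_{(y,\alpha)\to_f x,\ \lambda\searrow0}\inf_{u\in U}\frac{f(y+\lambda u)-\alpha}{\lambda}$, the supremum being over neighborhoods $U$ of $z$, where $(y,\alpha)\to_f x$ means $y\to x$, $\alpha\to f(x)$, $\alpha\ge f(y)$. $\partial^{CR}f(x)=\{x^*\in X^*:\langle x^*,z\rangle\le f^{\uparrow}(x,z)\ \forall z\in X\}$. *)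

theory Defs
  imports "HOL-Analysis.Analysis"
begin

(* The condition on V spells out convex V, which cannot be used inside a class specification. *)
class hausdorff_lcs = real_vector + topological_ab_group_add + t2_space +
  assumes tendsto_scaleR_Pair:
      "((\<lambda>p. fst p *\<^sub>R snd p) \<longlongrightarrow> c *\<^sub>R x) (nhds c \<times>\<^sub>F nhds x)"
    and locally_convex:
      "open U \<Longrightarrow> 0 \<in> U \<Longrightarrow> \<exists>V. open V \<and> 0 \<in> V \<and> V \<subseteq> U \<and>
         (\<forall>a\<in>V. \<forall>b\<in>V. \<forall>u\<ge>0. \<forall>v\<ge>0. u + v = 1 \<longrightarrow> u *\<^sub>R a + v *\<^sub>R b \<in> V)"

instance real_normed_vector \<subseteq> hausdorff_lcs
proof
  fix c :: real and x :: 'a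
  show "((\<lambda>p. fst p *\<^sub>R snd p) \<longlongrightarrow> c *\<^sub>R x) (nhds c \<times>\<^sub>F nhds x)"
    by (intro tendsto_scaleR filterlim_fst filterlim_snd)
next
  fix U :: "'a set"
  assume "open U" "0 \<in> U"
  then obtain r where "r > 0" "ball 0 r \<subseteq> U"
    by (auto simp: open_contains_ball)
  then show "\<exists>V. open V \<and> 0 \<in> V \<and> V \<subseteq> U \<and>
      (\<forall>a\<in>V. \<forall>b\<in>V. \<forall>u\<ge>0. \<forall>v\<ge>0. u + v = 1 \<longrightarrow> u *\<^sub>R a + v *\<^sub>R b \<in> V)"
    using convex_ball[of "0::'a" r, unfolded convex_def]
    by (intro exI[of _ "ball 0 r"] conjI) simp_all
qed

definition top_dual :: "('a::hausdorff_lcs \<Rightarrow> real) set" where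
  "top_dual = {l. linear l \<and> continuous_on UNIV l}"

definition edom :: "('a \<Rightarrow> ereal) \<Rightarrow> 'a set" where
  "edom h = {x. h x < \<infinity>}"

definition proper :: "('a \<Rightarrow> ereal) \<Rightarrow> bool" where
  "proper f \<longleftrightarrow> (\<forall>x. f x \<noteq> -\<infinity>) \<and> edom f \<noteq> {}"

definition error_function :: "('a \<times> 'a \<Rightarrow> ereal) \<Rightarrow> bool" where
  "error_function e \<longleftrightarrow>
     (\<forall>x y. 0 \<le> e (x, y)) \<and> (\<forall>x y. e (x, y) = e (y, x)) \<and> edom e \<noteq> {}"

definition e_convex :: "('a::real_vector \<times> 'a \<Rightarrow> ereal) \<Rightarrow> ('a \<Rightarrow> ereal) \<Rightarrow> bool" where
  "e_convex e f \<longleftrightarrow>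
     edom f \<times> edom f \<subseteq> edom e \<and>
     (\<forall>x y. \<forall>t\<in>{0<..<1}.
        f (t *\<^sub>R x + (1 - t) *\<^sub>R y)
          \<le> ereal t * f x + ereal (1 - t) * f y + ereal (t * (1 - t)) * e (x, y))"

definition usc_on :: "'a::topological_space set \<Rightarrow> ('a \<Rightarrow> ereal) \<Rightarrow> bool" where
  "usc_on S g \<longleftrightarrow> (\<forall>x\<in>S. \<forall>c. g x < c \<longrightarrow> eventually (\<lambda>y. g y < c) (at x within S))"

definition e_conjugate ::
    "('a::hausdorff_lcs \<times> 'a \<Rightarrow> ereal) \<Rightarrow> 'a \<Rightarrow> ('a \<Rightarrow> ereal) \<Rightarrow> ('a \<Rightarrow> real) \<Rightarrow> ereal" where
  "e_conjugate e y f xs = (SUP x. ereal (xs x) - f x - e (x, y))"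

definition e_biconjugate ::
    "('a::hausdorff_lcs \<times> 'a \<Rightarrow> ereal) \<Rightarrow> 'a \<Rightarrow> ('a \<Rightarrow> ereal) \<Rightarrow> 'a \<Rightarrow> ereal" where
  "e_biconjugate e y f x = (SUP xs\<in>top_dual. ereal (xs x) - e_conjugate e y f xs)"

definition e_subdifferential ::
    "('a::hausdorff_lcs \<times> 'a \<Rightarrow> ereal) \<Rightarrow> ('a \<Rightarrow> ereal) \<Rightarrow> 'a \<Rightarrow> ('a \<Rightarrow> real) set" where
  "e_subdifferential e f x =
     {xs\<in>top_dual. x \<in> edom f \<and> (\<forall>y. ereal (xs (y - x)) \<le> f y - f x + e (x, y))}"

definition subdifferential :: "('a::hausdorff_lcs \<Rightarrow> ereal) \<Rightarrow> 'a \<Rightarrow> ('a \<Rightarrow> real) set" where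
  "subdifferential h x =
     {xs\<in>top_dual. x \<in> edom h \<and> (\<forall>y. ereal (xs (y - x)) \<le> h y - h x)}"

(* Only the values of h on the dual space matter; subgradients are taken in the space itself. *)
definition dual_subdifferential ::
    "(('a::hausdorff_lcs \<Rightarrow> real) \<Rightarrow> ereal) \<Rightarrow> ('a \<Rightarrow> real) \<Rightarrow> 'a set" where
  "dual_subdifferential h xs =
     {x. xs \<in> top_dual \<and> xs \<in> edom h \<and>
         (\<forall>zs\<in>top_dual. ereal (zs x - xs x) \<le> h zs - h xs)}"

(* The pairs (y, a) with y tending to x, a real tending to f x, and a \<ge> f y;
   meaningful where f x is finite. *)
definition epi_nhds :: "('a::topological_space \<Rightarrow> ereal) \<Rightarrow> 'a \<Rightarrow> ('a \<times> real) filter" where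
  "epi_nhds f x =
     inf (nhds x \<times>\<^sub>F nhds (real_of_ereal (f x))) (principal {(y, a). f y \<le> ereal a})"

definition cr_derivative :: "('a::hausdorff_lcs \<Rightarrow> ereal) \<Rightarrow> 'a \<Rightarrow> 'a \<Rightarrow> ereal" where
  "cr_derivative f x z =
     (SUP U\<in>{U. eventually (\<lambda>u. u \<in> U) (nhds z)}.
        Limsup (epi_nhds f x \<times>\<^sub>F at_right (0::real))
          (\<lambda>((y, a), r). INF u\<in>U. (f (y + r *\<^sub>R u) - ereal a) / ereal r))"

definition cr_subdifferential :: "('a::hausdorff_lcs \<Rightarrow> ereal) \<Rightarrow> 'a \<Rightarrow> ('a \<Rightarrow> real) set" where
  "cr_subdifferential f x =
     {xs\<in>top_dual. x \<in> edom f \<and> (\<forall>z. ereal (xs z) \<le> cr_derivative f x z)}"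

end

theory Submission
  imports Defs
begin

text \<open>
  Write \<open>g y = f y + e (y, x)\<close>, so that \<open>e_conjugate e x f\<close> and \<open>e_biconjugate e x f\<close> are the Fenchel
  conjugate and biconjugate of \<open>g\<close>. Membership in the \<open>e\<close>-subdifferential means equality in the
  Fenchel--Young inequality of \<open>g\<close> at \<open>x\<close>, and as soon as one such subgradient exists, \<open>g\<close> and its
  biconjugate agree at \<open>x\<close>, which gives the equivalences as in convex analysis. A
  Clarke--Rockafellar subgradient is an \<open>e\<close>-subgradient: for the direction \<open>y - x\<close> one tests the
  infimum in the difference quotient at \<open>(x', \<alpha>)\<close> with \<open>u = y - x'\<close>, where \<open>e\<close>-convexity bounds the
  quotient by \<open>f y - \<alpha> + e (x', y)\<close>.
\<close>

lemma e_conjugate_ge: "ereal (zs y) - f y - e (y, x) \<le> e_conjugate e x f zs"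
  unfolding e_conjugate_def by (rule SUP_upper) simp

lemma e_biconjugate_ge:
  "zs \<in> top_dual \<Longrightarrow> ereal (zs y) - e_conjugate e x f zs \<le> e_biconjugate e x f y"
  unfolding e_biconjugate_def by (rule SUP_upper)

text \<open>By the Fenchel--Young inequality for \<open>f y + e (y, x)\<close>, every term of the
  supremum obeys this bound. The assumptions keep opposite infinities out of the sum.\<close>

lemma e_biconjugate_le:
  assumes "f y \<noteq> -\<infinity>" "e (y, x) \<noteq> -\<infinity>"
  shows "e_biconjugate e x f y \<le> f y + e (y, x)"
  unfolding e_biconjugate_def
proof (rule SUP_least)
  fix zs
  show "ereal (zs y) - e_conjugate e x f zs \<le> f y + e (y, x)"
    using e_conjugate_ge[of zs y f e x] assms
    by (cases "f y"; cases "e (y, x)"; cases "e_conjugate e x f zs") auto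
qed

text \<open>For each \<open>y\<close> the subgradient inequality rearranges into a bound,
  independent of \<open>y\<close>, on the term of \<open>y\<close> in the conjugate; quantifying
  over \<open>y\<close> turns these bounds into one on the supremum.\<close>

lemma e_subdifferential_iff_conjugate:
  assumes lin: "xs \<in> top_dual" and x: "f x = ereal r"
    and f: "\<And>y. f y \<noteq> -\<infinity>" and e: "\<And>y. e (x, y) \<noteq> -\<infinity>" "\<And>y. e (y, x) = e (x, y)"
  shows "xs \<in> e_subdifferential e f x \<longleftrightarrow> e_conjugate e x f xs \<le> ereal (xs x - r)"
proof -
  have "linear xs"
    using lin by (simp add: top_dual_def)
  then have diff: "xs (y - x) = xs y - xs x" for y
    by (rule linear_diff)
  have "ereal (xs (y - x)) \<le> f y - f x + e (x, y)
      \<longleftrightarrow> ereal (xs y) - f y - e (y, x) \<le> ereal (xs x - r)" for y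
    using f[of y] e[of y] x
    by (cases "f y"; cases "e (x, y)") (auto simp: diff)
  then show ?thesis
    using lin x by (auto simp: e_subdifferential_def e_conjugate_def SUP_le_iff edom_def)
qed

text \<open>Apply \<open>e\<close>-convexity on the segment from \<open>x'\<close> to
  \<open>y\<close>, replace the value at \<open>x'\<close> by the larger \<open>a\<close>, and
  discard the nonpositive term \<open>- t * t * c\<close>. What remains is affine in
  \<open>t\<close> with value \<open>a\<close> at 0, so its difference quotient is constant.\<close>

lemma e_convex_quotient_le:
  assumes conv: "e_convex e f" and e: "e (y, x') = ereal c" "0 \<le> c"
    and y: "f y = ereal s" and x': "f x' \<noteq> -\<infinity>" "f x' \<le> ereal a"
    and t: "0 < t" "t < 1"
  shows "(f (x' + t *\<^sub>R (y - x')) - ereal a) / ereal t \<le> ereal (s - a + c)"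
proof -
  obtain b where b: "f x' = ereal b"
    using x' by (cases "f x'") auto
  have "b \<le> a"
    using x' b by simp
  have "x' + t *\<^sub>R (y - x') = t *\<^sub>R y + (1 - t) *\<^sub>R x'"
    by (simp add: algebra_simps)
  moreover have "f (t *\<^sub>R y + (1 - t) *\<^sub>R x')
      \<le> ereal t * f y + ereal (1 - t) * f x' + ereal (t * (1 - t)) * e (y, x')"
    using conv t unfolding e_convex_def by auto
  ultimately have "f (x' + t *\<^sub>R (y - x')) \<le> ereal (t * s + (1 - t) * b + t * (1 - t) * c)"
    using y b e by simp
  also have "t * s + (1 - t) * b + t * (1 - t) * c \<le> a + t * (s - a + c)"
  proof -
    have "(1 - t) * b \<le> (1 - t) * a" "0 \<le> t * t * c"
      using \<open>b \<le> a\<close> e t by (auto intro: mult_left_mono)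
    then show ?thesis
      by (simp add: algebra_simps)
  qed
  finally have le: "f (x' + t *\<^sub>R (y - x')) \<le> ereal (a + t * (s - a + c))"
    by simp
  show ?thesis
  proof (cases "f (x' + t *\<^sub>R (y - x'))")
    case (real v)
    then have "v - a \<le> (s - a + c) * t"
      using le by (simp add: algebra_simps)
    then show ?thesis
      using real t by (simp add: pos_divide_le_eq)
  qed (use le t in auto)
qed

lemma cr_derivative_le:
  assumes conv: "e_convex e f" and f: "\<And>y. f y \<noteq> -\<infinity>" and e: "\<And>y z. 0 \<le> e (y, z)"
      "\<And>y z. e (y, z) = e (z, y)"
    and usc: "usc_on (edom f) (\<lambda>x'. e (x', y))"
    and x: "f x = ereal r" and y: "f y = ereal s" and c: "e (x, y) = ereal c"
  shows "cr_derivative f x (y - x) \<le> ereal (s - r + c)"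
  unfolding cr_derivative_def
proof (rule SUP_least)
  fix U
  assume "U \<in> {U. \<forall>\<^sub>F u in nhds (y - x). u \<in> U}"
  then have U: "\<forall>\<^sub>F u in nhds (y - x). u \<in> U"
    by simp
  show "Limsup (epi_nhds f x \<times>\<^sub>F at_right (0::real))
      (\<lambda>((y, a), t). INF u\<in>U. (f (y + t *\<^sub>R u) - ereal a) / ereal t) \<le> ereal (s - r + c)"
  \<comment> \<open>The slack \<open>d\<close> is split evenly: one half pays for replacing
    \<open>e (x', y)\<close> by \<open>c\<close>, the other for replacing \<open>a\<close> by
    \<open>r\<close>.\<close>
  proof (rule ereal_le_epsilon2)
    fix d :: real
    assume "0 < d"
    have "((\<lambda>x'. y - x') \<longlongrightarrow> y - x) (nhds x)"
      by (intro tendsto_intros filterlim_ident)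
    then have evU: "\<forall>\<^sub>F x' in nhds x. y - x' \<in> U"
      using U by (auto simp: filterlim_iff)
    have "x \<in> edom f"
      using x by (simp add: edom_def)
    moreover have "e (x, y) < ereal (c + d / 2)"
      using c \<open>0 < d\<close> by simp
    ultimately have "\<forall>\<^sub>F x' in at x within edom f. e (x', y) < ereal (c + d / 2)"
      using usc by (auto simp: usc_on_def)
    \<comment> \<open>The filter \<open>at x within edom f\<close> omits the point \<open>x\<close>
      itself, so the bound at \<open>x\<close> is supplied separately.\<close>
    then have evE: "\<forall>\<^sub>F x' in nhds x. x' \<in> edom f \<longrightarrow> e (x', y) < ereal (c + d / 2)"
      unfolding eventually_at_filter using \<open>e (x, y) < ereal (c + d / 2)\<close>
      by (auto elim: eventually_mono)
    have evA: "\<forall>\<^sub>F a in nhds r. r - d / 2 < a"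
      using order_tendstoD(1)[OF filterlim_ident, of "r - d / 2" r] \<open>0 < d\<close> by simp
    have "\<forall>\<^sub>F p in nhds x \<times>\<^sub>F nhds r. (y - fst p \<in> U
        \<and> (fst p \<in> edom f \<longrightarrow> e (fst p, y) < ereal (c + d / 2))) \<and> r - d / 2 < snd p"
      by (rule eventually_prodI[OF eventually_conj[OF evU evE] evA])
    then have ev1: "\<forall>\<^sub>F p in epi_nhds f x. f (fst p) \<le> ereal (snd p) \<and> y - fst p \<in> U
        \<and> (fst p \<in> edom f \<longrightarrow> e (fst p, y) < ereal (c + d / 2)) \<and> r - d / 2 < snd p"
      unfolding epi_nhds_def eventually_inf_principal using x
      by (auto elim: eventually_mono)
    have ev2: "\<forall>\<^sub>F t in at_right (0::real). 0 < t \<and> t < 1"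
      using eventually_at_right_less[of 0] eventually_at_right_real[of 0 1]
      by (auto elim: eventually_elim2)
    have "\<forall>\<^sub>F q in epi_nhds f x \<times>\<^sub>F at_right (0::real).
        (\<lambda>((y, a), t). INF u\<in>U. (f (y + t *\<^sub>R u) - ereal a) / ereal t) q
          \<le> ereal (s - r + c) + ereal d"
      using eventually_prodI[OF ev1 ev2]
    proof (rule eventually_mono)
      fix q :: "('a \<times> real) \<times> real"
      obtain x' a t where q: "q = ((x', a), t)"
        by (metis surj_pair)
      assume "(f (fst (fst q)) \<le> ereal (snd (fst q)) \<and> y - fst (fst q) \<in> U
        \<and> (fst (fst q) \<in> edom f \<longrightarrow> e (fst (fst q), y) < ereal (c + d / 2))
        \<and> r - d / 2 < snd (fst q)) \<and> 0 < snd q \<and> snd q < 1"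
      then have H: "f x' \<le> ereal a" "y - x' \<in> U" "r - d / 2 < a" "0 < t" "t < 1"
        and E: "x' \<in> edom f \<longrightarrow> e (x', y) < ereal (c + d / 2)"
        by (auto simp: q)
      \<comment> \<open>Points of the epigraph have first component in the domain, so semicontinuity
        relative to \<open>edom f\<close> is enough.\<close>
      have "x' \<in> edom f"
        using H(1) by (auto simp: edom_def intro: le_less_trans)
      then have E': "e (y, x') < ereal (c + d / 2)"
        using E e(2) by metis
      then obtain c' where c': "e (y, x') = ereal c'" "0 \<le> c'" "c' < c + d / 2"
        using e(1)[of y x'] by (cases "e (y, x')") auto
      have "(INF u\<in>U. (f (x' + t *\<^sub>R u) - ereal a) / ereal t)
          \<le> (f (x' + t *\<^sub>R (y - x')) - ereal a) / ereal t"
        using H(2) by (rule INF_lower)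
      also have "\<dots> \<le> ereal (s - a + c')"
        by (rule e_convex_quotient_le[OF conv c'(1,2) y f H(1,4,5)])
      also have "\<dots> \<le> ereal (s - r + c) + ereal d"
        using H(3) c'(3) by simp
      finally show "(\<lambda>((y, a), t). INF u\<in>U. (f (y + t *\<^sub>R u) - ereal a) / ereal t) q
          \<le> ereal (s - r + c) + ereal d"
        by (simp add: q)
    qed
    then show "Limsup (epi_nhds f x \<times>\<^sub>F at_right (0::real))
      (\<lambda>((y, a), t). INF u\<in>U. (f (y + t *\<^sub>R u) - ereal a) / ereal t)
        \<le> ereal (s - r + c) + ereal d"
      by (rule Limsup_bounded)
  qed
qed

lemma cr_subdifferential_subset_e_subdifferential:
  assumes conv: "e_convex e f" and f: "\<And>y. f y \<noteq> -\<infinity>"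
    and e: "\<And>y z. 0 \<le> e (y, z)" "\<And>y z. e (y, z) = e (z, y)"
    and usc: "\<And>y. y \<in> edom f \<Longrightarrow> usc_on (edom f) (\<lambda>x'. e (x', y))"
  shows "cr_subdifferential f x \<subseteq> e_subdifferential e f x"
proof
  fix zs
  assume "zs \<in> cr_subdifferential f x"
  then have zs: "zs \<in> top_dual" "x \<in> edom f" "\<And>z. ereal (zs z) \<le> cr_derivative f x z"
    by (auto simp: cr_subdifferential_def)
  obtain r where r: "f x = ereal r"
    using zs(2) f[of x] by (cases "f x") (auto simp: edom_def)
  have "ereal (zs (y - x)) \<le> f y - f x + e (x, y)" for y
  \<comment> \<open>Only finite \<open>f y\<close> matters: if \<open>f y\<close> is infinite, so is
    the right-hand side.\<close>
  proof (cases "f y")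
    case (real s)
    then have "y \<in> edom f"
      by (simp add: edom_def)
    then have "e (x, y) < \<infinity>"
      using conv zs(2) by (auto simp: e_convex_def edom_def)
    then obtain c where c: "e (x, y) = ereal c"
      using e(1)[of x y] by (cases "e (x, y)") auto
    have "ereal (zs (y - x)) \<le> ereal (s - r + c)"
      using zs(3) cr_derivative_le[OF conv f e usc[OF \<open>y \<in> edom f\<close>] r real c]
      by (rule order_trans)
    then show ?thesis
      using c r real by simp
  qed (use f[of y] e(1)[of x y] r in auto)
  then show "zs \<in> e_subdifferential e f x"
    using zs by (simp add: e_subdifferential_def)
qed

theorem proposition12:
  fixes e :: "'a::hausdorff_lcs \<times> 'a \<Rightarrow> ereal"
    and f :: "'a \<Rightarrow> ereal"
    and x :: 'a
    and xs :: "'a \<Rightarrow> real"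
  assumes "error_function e"
    and "proper f"
    and "e_convex e f"
    and "edom e = UNIV"
    and "\<forall>x y z. e (z, x) \<le> e (z, y) + e (y, x)"
    and "\<forall>z\<in>edom f. e (z, z) = 0 \<and> usc_on (edom f) (\<lambda>y. e (y, z))"
    and "x \<in> edom f"
    and "cr_subdifferential f x \<noteq> {}"
    and "xs \<in> top_dual"
  shows "(xs \<in> e_subdifferential e f x \<longleftrightarrow> x \<in> dual_subdifferential (e_conjugate e x f) xs) \<and>
         (x \<in> dual_subdifferential (e_conjugate e x f) xs \<longleftrightarrow>
            xs \<in> subdifferential (e_biconjugate e x f) x)"
proof -
  let ?C = "e_conjugate e x f" and ?B = "e_biconjugate e x f"
  have f: "f y \<noteq> -\<infinity>" for y
    using assms(2) by (simp add: proper_def)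
  have sym: "e (y, z) = e (z, y)" and nonneg: "0 \<le> e (y, z)" for y z
    using assms(1) by (auto simp: error_function_def)
  have e: "e (y, z) \<noteq> -\<infinity>" for y z
    using nonneg[of y z] by auto
  obtain r where r: "f x = ereal r"
    using assms(7) f[of x] by (cases "f x") (auto simp: edom_def)
  have exx: "e (x, x) = 0"
    using assms(6,7) by blast
  \<comment> \<open>This is the term of \<open>x\<close> in the supremum. It turns the upper bound
    that characterizes \<open>e\<close>-subgradients into an equality.\<close>
  have C_ge: "ereal (ws x - r) \<le> ?C ws" for ws
    using e_conjugate_ge[of ws x f e x] r exx by simp
  have fenchel: "ws \<in> e_subdifferential e f x \<longleftrightarrow> ?C ws = ereal (ws x - r)"
    if "ws \<in> top_dual" for ws
    using e_subdifferential_iff_conjugate[of ws f x r e, OF that r f e sym] C_ge[of ws] by auto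
  \<comment> \<open>The subgradient \<open>zs\<close> is unrelated to \<open>xs\<close>. It serves
    to identify the biconjugate at \<open>x\<close> with \<open>f x\<close>, and as a test point in
    the subgradient inequality of the conjugate.\<close>
  obtain zs where "zs \<in> cr_subdifferential f x"
    using assms(8) by blast
  then have "zs \<in> e_subdifferential e f x"
    using cr_subdifferential_subset_e_subdifferential[of e f x, OF assms(3) f nonneg sym] assms(6)
    by blast
  moreover from this have zs: "zs \<in> top_dual"
    by (simp add: e_subdifferential_def)
  ultimately have Czs: "?C zs = ereal (zs x - r)"
    using fenchel by blast
  have Bx: "?B x = ereal r"
  proof (rule antisym)
    show "?B x \<le> ereal r"
      using e_biconjugate_le[of f x e x] f e r exx by simp
    show "ereal r \<le> ?B x"
      using e_biconjugate_ge[OF zs, of x e x f] Czs by simp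
  qed
  have "x \<in> dual_subdifferential ?C xs" if "?C xs = ereal (xs x - r)"
  proof -
    have "ereal (ws x - xs x) \<le> ?C ws - ?C xs" for ws
      using C_ge[of ws] that by (cases "?C ws") auto
    then show ?thesis
      using assms(9) that by (simp add: dual_subdifferential_def edom_def)
  qed
  \<comment> \<open>Testing with \<open>zs\<close>, whose conjugate value is known, bounds
    \<open>?C xs\<close> from above by \<open>xs x - r\<close>; \<open>C_ge\<close> is the opposite
    bound.\<close>
  moreover have "?C xs = ereal (xs x - r)" if "x \<in> dual_subdifferential ?C xs"
  proof -
    have "ereal (zs x - xs x) \<le> ?C zs - ?C xs"
      using that zs by (auto simp: dual_subdifferential_def)
    then show ?thesis
      using Czs C_ge[of xs] by (cases "?C xs") auto
  qed
  moreover have diff: "xs (y - x) = xs y - xs x" for y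
    using assms(9) by (auto simp: top_dual_def linear_diff)
  \<comment> \<open>By the equality, the affine function that \<open>xs\<close> contributes to the
    biconjugate takes the value \<open>r = ?B x\<close> at \<open>x\<close>, so it supports
    \<open>?B\<close> there.\<close>
  have "xs \<in> subdifferential ?B x" if "?C xs = ereal (xs x - r)"
  proof -
    have "ereal (xs (y - x)) \<le> ?B y - ?B x" for y
      using e_biconjugate_ge[OF assms(9), of y e x f] that Bx
      by (cases "?B y") (auto simp: diff)
    then show ?thesis
      using assms(9) Bx by (simp add: subdifferential_def edom_def)
  qed
  \<comment> \<open>The biconjugate lies below \<open>f y + e (y, x)\<close> and touches it at
    \<open>y = x\<close>, so its subgradient inequality at \<open>x\<close> passes to the larger
    function.\<close>
  moreover have "xs \<in> e_subdifferential e f x" if "xs \<in> subdifferential ?B x"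
  proof -
    have "ereal (xs (y - x)) \<le> f y - f x + e (x, y)" for y
    proof -
      have "ereal (xs (y - x)) \<le> ?B y - ?B x"
        using that by (simp add: subdifferential_def)
      also have "\<dots> \<le> f y + e (y, x) - ereal r"
        unfolding Bx using f e by (intro ereal_minus_mono e_biconjugate_le) auto
      also have "\<dots> = f y - f x + e (x, y)"
        using f[of y] e[of x y] r
        by (cases "f y"; cases "e (x, y)") (auto simp: sym[of y x])
      finally show ?thesis .
    qed
    then show ?thesis
      using assms(7,9) by (simp add: e_subdifferential_def)
  qed
  ultimately show ?thesis
    using fenchel[OF assms(9)] by blast
qed

end
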